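(* Let $\xi=(\xi_t)_{0\le t\le T}$ be a progressively measurable target process with $\xi_0\in L^2(\mathbb P)$ and $\mathbb E\int_0^T\xi_t^2\,dt<\infty$, and let $x\in\mathbb R$. Suppose that for some constants $L>0$ and $\alpha>0$, $$\omega_\xi(h)\le Lh^\alpha,\qquad h>0.$$ Then for every $\kappa>0$, $$v(\kappa)\le\sqrt\kappa\,\mathbb E[(x-\xi_0)^2]+2L\,\kappa^{\alpha/2}\,\Gamma(\alpha+1).$$ Consequently, for $0<\kappa\le 1$, $$v(\kappa)\le \kappa^{(\alpha\wedge 1)/2}\left(\mathbb E[(x-\xi_0)^2]+2L\,\Gamma(\alpha+1)\right).$$ In particular, if $[\xi]^2_{\rm tr}<\infty$, then for all $\kappa>0$, $$v(\kappa)\le\sqrt\kappa\,\bigl(\mathbb E[(x-\xi_0)^2]+2[\xi]^2_{\rm tr}\bigr).$$ Finally, if $x=\xi_0$ almost surely (and $\omega_\xi(h)\le Lh^\alpha$ for all $h>0$), the sharper estimate $$v(\kappa)\le L\,\kappa^{\alpha/2}\,\Gamma(\alpha+1),\qquad\kappa>0,$$ holds.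
   Context: Fix $T>0$, a filtered probability space $(\Omega,\mathcal F,(\mathcal F_t)_{0\le t\le T},\mathbb P)$ satisfying the usual conditions, and $x\in\mathbb R$. Let $\mathcal U$ be the set of progressively measurable processes $u=(u_t)_{0\le t\le T}$ with $\mathbb E\int_0^T u_t^2\,dt<\infty$, and for $u\in\mathcal U$ let $X^u_t=x+\int_0^t u_s\,ds$. For $\kappa\ge 0$ set $$J_\kappa(u)=\mathbb E\Big[\tfrac12\int_0^T(X^u_t-\xi_t)^2\,dt+\tfrac{\kappa}{2}\int_0^Tu_t^2\,dt\Big],\qquad v(\kappa)=\inf_{u\in\mathcal U}J_\kappa(u).$$ Further, $\omega_\xi(h)=\mathbb E\int_0^T|\xi_t-\xi_{(t-h)^+}|^2\,dt$ for $h>0$, where $(t-h)^+=\max\{t-h,0\}$, and $[\xi]^2_{\rm tr}=\sup_{h>0}\omega_\xi(h)/h$. $\Gamma$ is the Gamma function and $a\wedge b=\min\{a,b\}$. *)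

theory Defs
  imports "HOL-Probability.Probability"
begin

text \<open>
  Filtrations are indexed by \<open>[0, T]\<close>, so nothing is required of \<open>F t\<close> for \<open>t\<close> outside this
  interval, and only the \<open>\<sigma>\<close>-algebra of the measure space \<open>F t\<close> matters. The usual conditions are
  completeness, all null sets being in \<open>F 0\<close>, and right-continuity.
\<close>

locale usual_filtered_prob_space = prob_space M + complete_measure M
  for M :: "'a measure" +
  fixes F :: "real \<Rightarrow> 'a measure" and T :: real
  assumes T_pos: "0 < T"
    and subalg: "\<And>t. t \<in> {0..T} \<Longrightarrow> subalgebra M (F t)"
    and F_mono: "\<And>s t. 0 \<le> s \<Longrightarrow> s \<le> t \<Longrightarrow> t \<le> T \<Longrightarrow> sets (F s) \<subseteq> sets (F t)"
    and null_sets_F0: "null_sets M \<subseteq> sets (F 0)"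
    and right_continuous: "\<And>t. 0 \<le> t \<Longrightarrow> t < T \<Longrightarrow> sets (F t) = (\<Inter>s\<in>{t<..T}. sets (F s))"

definition progressively_measurable ::
  "(real \<Rightarrow> 'a measure) \<Rightarrow> real \<Rightarrow> (real \<Rightarrow> 'a \<Rightarrow> real) \<Rightarrow> bool"
where
  "progressively_measurable F T u \<longleftrightarrow>
     (\<forall>t\<in>{0..T}. (\<lambda>(s, \<omega>). u s \<omega>) \<in> borel_measurable (restrict_space borel {0..t} \<Otimes>\<^sub>M F t))"

text \<open>
  Expectations and time integrals of nonnegative quantities are taken in \<open>[0, \<infinity>]\<close>
  (type \<^typ>\<open>ennreal\<close>), so that they are meaningful without integrability side conditions.
\<close>

definition expected_energy :: "'a measure \<Rightarrow> real \<Rightarrow> (real \<Rightarrow> 'a \<Rightarrow> real) \<Rightarrow> ennreal" where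
  "expected_energy M T u = (\<integral>\<^sup>+\<omega>. (\<integral>\<^sup>+t\<in>{0..T}. ennreal ((u t \<omega>)\<^sup>2) \<partial>lborel) \<partial>M)"

definition controls ::
  "'a measure \<Rightarrow> (real \<Rightarrow> 'a measure) \<Rightarrow> real \<Rightarrow> (real \<Rightarrow> 'a \<Rightarrow> real) set"
where
  "controls M F T = {u. progressively_measurable F T u \<and> expected_energy M T u < \<infinity>}"

text \<open>
  For a control \<open>u\<close>, almost every path is integrable on \<open>[0, T]\<close>. On the exceptional null set
  the integral below is subject to the convention that non-integrable functions have integral 0.
\<close>

definition controlled_state :: "real \<Rightarrow> (real \<Rightarrow> 'a \<Rightarrow> real) \<Rightarrow> real \<Rightarrow> 'a \<Rightarrow> real" where
  "controlled_state x u t \<omega> = x + (LINT s:{0..t}|lborel. u s \<omega>)"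

text \<open>Only \<open>\<kappa> \<ge> 0\<close> is meaningful, since \<^const>\<open>ennreal\<close> sends negative reals to 0.\<close>

definition tracking_cost ::
  "'a measure \<Rightarrow> real \<Rightarrow> real \<Rightarrow> (real \<Rightarrow> 'a \<Rightarrow> real) \<Rightarrow> real \<Rightarrow> (real \<Rightarrow> 'a \<Rightarrow> real) \<Rightarrow> ennreal"
where
  "tracking_cost M T x \<xi> \<kappa> u =
     (\<integral>\<^sup>+\<omega>. (ennreal (1 / 2) *
               (\<integral>\<^sup>+t\<in>{0..T}. ennreal ((controlled_state x u t \<omega> - \<xi> t \<omega>)\<^sup>2) \<partial>lborel)
           + ennreal (\<kappa> / 2) * (\<integral>\<^sup>+t\<in>{0..T}. ennreal ((u t \<omega>)\<^sup>2) \<partial>lborel)) \<partial>M)"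

definition tracking_value ::
  "'a measure \<Rightarrow> (real \<Rightarrow> 'a measure) \<Rightarrow> real \<Rightarrow> real \<Rightarrow> (real \<Rightarrow> 'a \<Rightarrow> real) \<Rightarrow> real \<Rightarrow> ennreal"
where
  "tracking_value M F T x \<xi> \<kappa> = (INF u\<in>controls M F T. tracking_cost M T x \<xi> \<kappa> u)"

definition time_modulus ::
  "'a measure \<Rightarrow> real \<Rightarrow> (real \<Rightarrow> 'a \<Rightarrow> real) \<Rightarrow> real \<Rightarrow> ennreal"
where
  "time_modulus M T \<xi> h =
     (\<integral>\<^sup>+\<omega>. (\<integral>\<^sup>+t\<in>{0..T}. ennreal (\<bar>\<xi> t \<omega> - \<xi> (max (t - h) 0) \<omega>\<bar>\<^sup>2) \<partial>lborel) \<partial>M)"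

definition tr_seminorm_sq :: "'a measure \<Rightarrow> real \<Rightarrow> (real \<Rightarrow> 'a \<Rightarrow> real) \<Rightarrow> ennreal" where
  "tr_seminorm_sq M T \<xi> = (SUP h\<in>{0<..}. time_modulus M T \<xi> h / ennreal h)"

end

theory Submission
  imports Defs
begin

text \<open>
  The feedback control \<open>u = (\<xi> - X) / \<surd>\<kappa>\<close> makes the two parts of the cost equal, so the cost is
  \<open>E \<integral> (X - \<xi>)\<^sup>2\<close>, where \<open>X\<close> is the exponential filter of \<open>\<xi>\<close> at time scale \<open>\<lambda> = \<surd>\<kappa>\<close>. Extending
  \<open>\<xi>\<close> by \<open>\<xi>\<^sub>0\<close> to negative times, \<open>X\<^sub>t - \<xi>\<^sub>t\<close> is \<open>exp (- t / \<lambda>) (x - \<xi>\<^sub>0)\<close> plus the mean of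
  \<open>\<xi>\<close> at time \<open>t - h\<close> minus \<open>\<xi>\<^sub>t\<close> over an exponentially distributed delay \<open>h\<close> of mean \<open>\<lambda>\<close>. Jensen's
  inequality and Tonelli's theorem bound the second part by the mean of \<open>\<omega>\<^sub>\<xi>(h)\<close>, which is at most
  \<open>L \<lambda>\<^sup>\<alpha> \<Gamma>(\<alpha> + 1)\<close>. The factor 2 comes from \<open>(a + b)\<^sup>2 \<le> 2 a\<^sup>2 + 2 b\<^sup>2\<close>, which is not needed when
  \<open>x = \<xi>\<^sub>0\<close>.
\<close>

section \<open>The exponential filter and the exponential delay for a single path\<close>

text \<open>Variation of constants for the linear equation \<open>X' = (f - X) / lam\<close> with
  \<open>X 0 = x\<close>. The closed formula is total: if the weighted path is not integrable, the
  integral is 0 by convention.\<close>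

definition exp_filter :: "real \<Rightarrow> real \<Rightarrow> (real \<Rightarrow> real) \<Rightarrow> real \<Rightarrow> real" where
  "exp_filter lam x f t =
     exp (- t / lam) * (x + (LINT s:{0..t}|lborel. exp (s / lam) * f s) / lam)"

text \<open>Jensen's inequality for the square. If the square is integrable, it is nonnegativity of
  the variance; otherwise the right-hand side is infinite.\<close>

lemma (in prob_space) square_expectation_le_nn_integral:
  fixes g :: "'a \<Rightarrow> real"
  assumes "g \<in> borel_measurable M"
  shows "ennreal ((expectation g)\<^sup>2) \<le> (\<integral>\<^sup>+\<omega>. ennreal ((g \<omega>)\<^sup>2) \<partial>M)"
proof (cases "integrable M (\<lambda>\<omega>. (g \<omega>)\<^sup>2)")
  case True
  then have "integrable M g"
    by (rule square_integrable_imp_integrable[OF assms])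
  with True have "(expectation g)\<^sup>2 \<le> expectation (\<lambda>\<omega>. (g \<omega>)\<^sup>2)"
    using variance_positive[of g] variance_eq[of g] by simp
  then show ?thesis
    using nn_integral_eq_integral[OF True] by (simp add: ennreal_leI)
next
  case False
  moreover have "(\<lambda>\<omega>. (g \<omega>)\<^sup>2) \<in> borel_measurable M"
    using assms by measurable
  ultimately have "\<not> (\<integral>\<^sup>+\<omega>. ennreal ((g \<omega>)\<^sup>2) \<partial>M) < \<infinity>"
    using integrableI_nonneg[of "\<lambda>\<omega>. (g \<omega>)\<^sup>2" M] AE_I2[of M "\<lambda>\<omega>. 0 \<le> (g \<omega>)\<^sup>2"]
      zero_le_power2 by blast
  then have "(\<integral>\<^sup>+\<omega>. ennreal ((g \<omega>)\<^sup>2) \<partial>M) = top"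
    unfolding infinity_ennreal_def less_top[symmetric] by blast
  then show ?thesis
    by (simp only: top_greatest)
qed

text \<open>Rescaling \<open>h\<close> by \<open>lam\<close> takes out the factor
  \<open>lam powr a\<close> and leaves Euler's integral. This is the source of the Gamma function in
  the final bounds.\<close>

lemma nn_integral_exponential_powr:
  assumes "0 < lam" "0 < a"
  shows "(\<integral>\<^sup>+h. ennreal (h powr a) \<partial>density lborel (exponential_density (1 / lam)))
           = ennreal (lam powr a * Gamma (a + 1))"
proof -
  have "(\<integral>\<^sup>+h. ennreal (h powr a) \<partial>density lborel (exponential_density (1 / lam)))
      = (\<integral>\<^sup>+h. ennreal (exponential_density (1 / lam) h) * ennreal (h powr a) \<partial>lborel)"
    by (subst nn_integral_density) auto
  also have "\<dots> = ennreal lam *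
      (\<integral>\<^sup>+h. ennreal (exponential_density (1 / lam) (lam * h)) * ennreal ((lam * h) powr a) \<partial>lborel)"
    by (subst nn_integral_real_affine[where c = lam and t = 0]) (use assms in auto)
  also have "\<dots> = (\<integral>\<^sup>+h. ennreal lam *
      (ennreal (exponential_density (1 / lam) (lam * h)) * ennreal ((lam * h) powr a)) \<partial>lborel)"
    by (subst nn_integral_cmult) auto
  \<comment> \<open>The exponent \<open>a + 1 - 1\<close> and the division by \<open>exp h\<close>
    follow the integrand in \<open>Gamma_conv_nn_integral_real\<close>.\<close>
  also have "\<dots> = (\<integral>\<^sup>+h. ennreal (lam powr a) *
      ennreal (indicator {0..} h * h powr (a + 1 - 1) / exp h) \<partial>lborel)"
    using assms
    by (intro nn_integral_cong)
      (auto simp: ennreal_mult'[symmetric] exponential_density_def powr_mult exp_minus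
        mult_less_0_iff field_simps indicator_def)
  also have "\<dots> = ennreal (lam powr a) * ennreal (Gamma (a + 1))"
    using assms by (subst nn_integral_cmult) (auto simp: Gamma_conv_nn_integral_real)
  finally show ?thesis by (simp add: ennreal_mult')
qed

lemma LINT_exp_Icc:
  fixes lam r t :: real
  assumes "0 < lam" "r \<le> t"
  shows "(LINT s:{r..t}|lborel. exp (- s / lam)) = lam * (exp (- r / lam) - exp (- t / lam))"
proof -
  have "(LINT s|lborel. indicator {r..t} s *\<^sub>R exp (- s / lam))
      = (- lam * exp (- t / lam)) - (- lam * exp (- r / lam))"
    using assms
    by (intro integral_FTC_Icc[where F = "\<lambda>s. - lam * exp (- s / lam)"])
      (auto intro!: derivative_eq_intros continuous_intros
        simp: has_real_derivative_iff_has_vector_derivative[symmetric])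
  then show ?thesis
    by (simp add: set_lebesgue_integral_def algebra_simps)
qed

lemma set_integrable_exp_mult:
  fixes f :: "real \<Rightarrow> real"
  assumes lam: "0 < lam" and f: "set_integrable lborel {0..t} f"
  shows "set_integrable lborel {0..t} (\<lambda>r. exp (r / lam) * f r)"
  unfolding set_integrable_def
proof (rule Bochner_Integration.integrable_bound)
  have fi: "integrable lborel (\<lambda>r. indicator {0..t} r * f r)"
    using f by (simp add: set_integrable_def)
  then show "integrable lborel (\<lambda>r. exp (t / lam) * (indicator {0..t} r * f r))"
    by simp
  have "(\<lambda>r. indicator {0..t} r *\<^sub>R (exp (r / lam) * f r)) = (\<lambda>r. exp (r / lam) * (indicator {0..t} r * f r))"
    by auto
  also have "\<dots> \<in> borel_measurable lborel"
    using borel_measurable_integrable[OF fi] by measurable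
  finally show "(\<lambda>r. indicator {0..t} r *\<^sub>R (exp (r / lam) * f r)) \<in> borel_measurable lborel" .
  show "AE r in lborel. norm (indicator {0..t} r *\<^sub>R (exp (r / lam) * f r))
      \<le> norm (exp (t / lam) * (indicator {0..t} r * f r))"
    using lam by (auto simp: indicator_def abs_mult divide_right_mono intro!: mult_right_mono)
qed

text \<open>Fubini, since the path \<open>f\<close> is merely integrable and the filter need not be differentiable.\<close>
lemma exp_filter_integral_equation:
  assumes lam: "0 < lam" and t: "0 \<le> t" and f: "set_integrable lborel {0..t} f"
  shows "x + (LINT s:{0..t}|lborel. (f s - exp_filter lam x f s) / lam) = exp_filter lam x f t"
proof -
  define g where "g r = indicator {0..t} r * (exp (r / lam) * f r)" for r
  have fi: "integrable lborel (\<lambda>s. indicator {0..t} s * f s)"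
    using f by (simp add: set_integrable_def)
  have g: "integrable lborel g"
    using set_integrable_exp_mult[OF lam f] by (simp add: set_integrable_def g_def[abs_def])
  have [measurable]: "g \<in> borel_measurable borel"
    using borel_measurable_integrable[OF g] by simp
  \<comment> \<open>The integrand lives on the triangle \<open>0 \<le> r \<le> s \<le> t\<close>.
    Integrating out \<open>r\<close> gives \<open>lam\<close> times the memory term of the filter at
    \<open>s\<close>; integrating out \<open>s\<close> only involves an exponential.\<close>
  define H where "H s r = indicator {0..t} s * (indicator {0..s} r * exp (- s / lam) * g r)" for s r :: real
  have H: "integrable (lborel \<Otimes>\<^sub>M lborel) (case_prod H)"
  \<comment> \<open>Since \<open>exp (- s / lam) \<le> 1\<close> for \<open>s \<ge> 0\<close>,
    \<open>H\<close> is dominated by a product of integrable functions of \<open>s\<close> and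
    \<open>r\<close>.\<close>
  proof (rule Bochner_Integration.integrable_bound)
    show "integrable (lborel \<Otimes>\<^sub>M lborel) (\<lambda>(s, r). indicator {0..t} s * g r :: real)"
    proof (rule lborel_pair.Fubini_integrable)
      show "integrable lborel (\<lambda>s. LINT r|lborel. norm (case (s, r) of (s, r) \<Rightarrow> indicator {0..t} s * g r))"
        using t integrable_real_indicator[of "{0..t}" lborel]
        by (simp add: abs_mult)
    qed (auto intro!: integrable_mult_right g)
    show "case_prod H \<in> borel_measurable (lborel \<Otimes>\<^sub>M lborel)"
      unfolding H_def indicator_def atLeastAtMost_iff by measurable
    show "AE p in lborel \<Otimes>\<^sub>M lborel. norm (case_prod H p) \<le> norm (case p of (s, r) \<Rightarrow> indicator {0..t} s * g r)"
      using lam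
      by (intro AE_I2) (auto simp: H_def indicator_def abs_mult split_beta intro!: mult_left_le_one_le)
  qed
  have left: "(LINT r|lborel. H s r) = indicator {0..t} s * (exp (- s / lam) * (LINT r:{0..s}|lborel. exp (r / lam) * f r))" for s
  proof -
    have "(LINT r|lborel. H s r) = (LINT r|lborel. (indicator {0..t} s * exp (- s / lam)) * (indicator {0..s} r * (exp (r / lam) * f r)))"
      by (rule Bochner_Integration.integral_cong) (auto simp: H_def g_def indicator_def)
    then show ?thesis by (simp add: set_lebesgue_integral_def)
  qed
  \<comment> \<open>For \<open>r\<close> in \<open>{0..t}\<close> the variable \<open>s\<close> runs
    over \<open>{r..t}\<close>. The endpoint \<open>r\<close> contributes
    \<open>exp (- r / lam)\<close>, which cancels the weight in \<open>g r\<close> and leaves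
    \<open>f r\<close> itself.\<close>
  have right: "(LINT s|lborel. H s r) = lam * (indicator {0..t} r * f r) - lam * exp (- t / lam) * g r" for r
  proof (cases "r \<in> {0..t}")
    case True
    have "(LINT s|lborel. H s r) = (LINT s|lborel. g r * (indicator {r..t} s * exp (- s / lam)))"
      using True by (intro Bochner_Integration.integral_cong) (auto simp: H_def indicator_def)
    also have "\<dots> = g r * (LINT s:{r..t}|lborel. exp (- s / lam))"
      by (simp add: set_lebesgue_integral_def)
    also have "\<dots> = g r * (lam * (exp (- r / lam) - exp (- t / lam)))"
      using True lam by (subst LINT_exp_Icc) auto
    also have "\<dots> = lam * (indicator {0..t} r * f r) - lam * exp (- t / lam) * g r"
      using True by (simp add: g_def algebra_simps exp_minus)
    finally show ?thesis .
  qed (simp add: H_def g_def)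
  have E: "integrable lborel (\<lambda>s. indicator {0..t} s * (exp (- s / lam) :: real))"
    using borel_integrable_atLeastAtMost'[of 0 t "\<lambda>s. exp (- s / lam)"] lam
    by (simp add: set_integrable_def continuous_intros)
  have Li: "integrable lborel (\<lambda>s. LINT r|lborel. H s r)"
    using lborel_pair.integrable_fst[OF H] by simp
  have L: "(LINT s|lborel. LINT r|lborel. H s r)
     = lam * (LINT s:{0..t}|lborel. f s) - lam * exp (- t / lam) * (LINT r:{0..t}|lborel. exp (r / lam) * f r)"
  proof -
    have "(LINT s|lborel. LINT r|lborel. H s r) = (LINT r|lborel. LINT s|lborel. H s r)"
      using lborel_pair.Fubini_integral[OF H] by simp
    also have "\<dots> = lam * (LINT s|lborel. indicator {0..t} s * f s) - lam * exp (- t / lam) * (LINT r|lborel. g r)"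
      unfolding right by (subst Bochner_Integration.integral_diff) (use fi g in auto)
    finally show ?thesis by (simp add: set_lebesgue_integral_def g_def[abs_def])
  qed
  have "(LINT s:{0..t}|lborel. (f s - exp_filter lam x f s) / lam)
     = (LINT s|lborel. (indicator {0..t} s * f s) / lam - (x / lam) * (indicator {0..t} s * exp (- s / lam)) - (LINT r|lborel. H s r) / lam\<^sup>2)"
    unfolding set_lebesgue_integral_def
    by (rule Bochner_Integration.integral_cong)
      (use lam in \<open>auto simp: left exp_filter_def field_simps power2_eq_square set_lebesgue_integral_def\<close>)
  also have "\<dots> = (LINT s:{0..t}|lborel. f s) / lam - (x / lam) * (LINT s:{0..t}|lborel. exp (- s / lam)) - (LINT s|lborel. LINT r|lborel. H s r) / lam\<^sup>2"
    using fi E Li by (simp add: set_lebesgue_integral_def)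
  \<comment> \<open>The two integrals of \<open>f\<close> without weight cancel; the endpoint terms
    at \<open>t\<close> form the filter and the one at 0 gives \<open>- x\<close>.\<close>
  also have "\<dots> = exp_filter lam x f t - x"
    unfolding L LINT_exp_Icc[OF lam t] using lam
    by (simp add: exp_filter_def field_simps power2_eq_square)
  finally show ?thesis by simp
qed

text \<open>On \<open>{0..t}\<close> the filter kernel is the exponential density of the delay
  \<open>h = t - s\<close>, of total mass \<open>1 - exp (- t / lam)\<close>. The missing mass is
  the probability of a delay beyond \<open>t\<close>, where \<open>max (t - h) 0\<close> reads
  \<open>f 0\<close>. Adding and subtracting that contribution turns the weight on \<open>x\<close>
  into a weight on \<open>x - f 0\<close>.\<close>

lemma exp_filter_diff:
  assumes lam: "0 < lam" and t: "0 \<le> t" and [measurable]: "f \<in> borel_measurable borel"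
    and f: "set_integrable lborel {0..t} f"
  shows "exp_filter lam x f t - f t = exp (- t / lam) * (x - f 0)
    + (LINT h|density lborel (exponential_density (1 / lam)). f (max (t - h) 0) - f t)"
proof -
  let ?k = "exponential_density (1 / lam)"
  let ?P = "density lborel ?k"
  interpret P: prob_space ?P
    using lam by (intro prob_space_exponential_density) simp
  define g where "g r = indicator {0..t} r * (exp (r / lam) * f r)" for r
  have g: "integrable lborel g"
    using set_integrable_exp_mult[OF lam f] by (simp add: set_integrable_def g_def[abs_def])
  have tail: "P.prob {t<..} = exp (- t / lam)"
  proof -
    have "distributed ?P lborel (\<lambda>x. x) ?k"
      using lam by (auto simp: distributed_def exponential_density_nonneg distr_id2)
    from P.exponential_distributedD_gt[OF this t] lam show ?thesis
      by (simp add: greaterThan_def)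
  qed
  have gi: "integrable lborel (\<lambda>h. exp (- t / lam) / lam * g (t - h))"
    using lborel_integrable_real_affine[OF g, of "-1" t] by simp
  have gI: "(LINT h|lborel. g (t - h)) = (LINT s:{0..t}|lborel. exp (s / lam) * f s)"
    using lborel_integral_real_affine[of "-1" g t] by (simp add: set_lebesgue_integral_def g_def[abs_def])
  \<comment> \<open>Both sides vanish for \<open>h < 0\<close> and for \<open>h > t\<close>: on the
    left through the density and the indicator, on the right because \<open>g\<close> is supported
    on \<open>{0..t}\<close>.\<close>
  have eq: "?k h *\<^sub>R (indicator {..t} h * f (max (t - h) 0)) = exp (- t / lam) / lam * g (t - h)" for h
  proof -
    have "exp (- t / lam) * exp ((t - h) / lam) = exp (- h / lam)"
      by (simp add: exp_add[symmetric] diff_divide_distrib)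
    then show ?thesis
      by (auto simp: exponential_density_def g_def indicator_def)
  qed
  have i1: "integrable ?P (\<lambda>h. indicator {..t} h * f (max (t - h) 0))"
    using lam gi by (subst integrable_density) (auto simp: exponential_density_nonneg eq simp del: real_scaleR_def)
  have i2: "integrable ?P (\<lambda>h. indicator {t<..} h * f 0)"
    by (rule P.integrable_const_bound[where B = "\<bar>f 0\<bar>"]) (auto simp: indicator_def)
  have split: "(\<lambda>h. f (max (t - h) 0)) = (\<lambda>h. indicator {..t} h * f (max (t - h) 0) + indicator {t<..} h * f 0)"
    by (auto simp: indicator_def fun_eq_iff)
  have int: "integrable ?P (\<lambda>h. f (max (t - h) 0))"
    by (subst split) (intro Bochner_Integration.integrable_add i1 i2)
  have "(LINT h|?P. f (max (t - h) 0)) = (LINT h|?P. indicator {..t} h * f (max (t - h) 0)) + (LINT h|?P. indicator {t<..} h * f 0)"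
    by (subst split) (intro Bochner_Integration.integral_add i1 i2)
  also have "(LINT h|?P. indicator {t<..} h * f 0) = exp (- t / lam) * f 0"
    using tail by simp
  also have "(LINT h|?P. indicator {..t} h * f (max (t - h) 0)) = exp (- t / lam) / lam * (LINT s:{0..t}|lborel. exp (s / lam) * f s)"
    using lam by (subst integral_density) (auto simp: exponential_density_nonneg eq gI simp del: real_scaleR_def)
  finally have "(LINT h|?P. f (max (t - h) 0) - f t)
      = exp (- t / lam) / lam * (LINT s:{0..t}|lborel. exp (s / lam) * f s) + exp (- t / lam) * f 0 - f t"
    using int P.prob_space by simp
  then show ?thesis
    by (simp add: exp_filter_def algebra_simps)
qed

section \<open>Measurability of the filter and of the feedback\<close>

text \<open>The upper limit of integration depends on the time argument, so the integral is taken
  over the whole line with the limits inside the integrand. The space \<open>N\<close> is left open: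
  \<open>F t\<close> gives progressive and \<open>M\<close> joint measurability.\<close>

lemma borel_measurable_exp_filter:
  fixes f :: "real \<Rightarrow> 'a \<Rightarrow> real"
  assumes [measurable]: "(\<lambda>(s, \<omega>). f s \<omega>) \<in> borel_measurable (borel \<Otimes>\<^sub>M N)"
  shows "(\<lambda>(s, \<omega>). exp_filter lam x (\<lambda>r. f r \<omega>) s) \<in> borel_measurable (borel \<Otimes>\<^sub>M N)"
proof -
  have "(\<lambda>(p, r). (if 0 \<le> r \<and> r \<le> fst p then exp (r / lam) * f r (snd p) else 0))
      \<in> borel_measurable ((borel \<Otimes>\<^sub>M N) \<Otimes>\<^sub>M lborel)"
    by measurable
  then have [measurable]: "(\<lambda>p. LINT r|lborel. (if 0 \<le> r \<and> r \<le> fst p then exp (r / lam) * f r (snd p) else 0))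
      \<in> borel_measurable (borel \<Otimes>\<^sub>M N)"
    by (rule lborel.borel_measurable_lebesgue_integral)
  have "(\<lambda>(s, \<omega>). exp_filter lam x (\<lambda>r. f r \<omega>) s) =
    (\<lambda>p. exp (- fst p / lam) * (x + (LINT r|lborel. (if 0 \<le> r \<and> r \<le> fst p then exp (r / lam) * f r (snd p) else 0)) / lam))"
    by (auto simp: exp_filter_def set_lebesgue_integral_def fun_eq_iff indicator_def
        intro!: Bochner_Integration.integral_cong arg_cong[where f = "\<lambda>z. z / lam"])
  also have "\<dots> \<in> borel_measurable (borel \<Otimes>\<^sub>M N)"
    by measurable
  finally show ?thesis .
qed

text \<open>Composition with the retraction of the line onto \<open>{0..t}\<close> trades the
  restricted time space for the full line, on which the filter is handled.\<close>

lemma progressively_measurable_clamp: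
  assumes "progressively_measurable F T u" "t \<in> {0..T}"
  shows "(\<lambda>(s, \<omega>). u (max 0 (min t s)) \<omega>) \<in> borel_measurable (borel \<Otimes>\<^sub>M F t)"
proof -
  have "(\<lambda>s::real. max 0 (min t s)) \<in> borel \<rightarrow>\<^sub>M restrict_space borel {0..t}"
    using assms(2) by (intro measurable_restrict_space2) auto
  then have "(\<lambda>p. (max 0 (min t (fst p)), snd p)) \<in> borel \<Otimes>\<^sub>M F t \<rightarrow>\<^sub>M restrict_space borel {0..t} \<Otimes>\<^sub>M F t"
    by (intro measurable_Pair measurable_compose[OF measurable_fst]) auto
  moreover have "(\<lambda>(s, \<omega>). u s \<omega>) \<in> borel_measurable (restrict_space borel {0..t} \<Otimes>\<^sub>M F t)"
    using assms by (simp add: progressively_measurable_def)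
  ultimately have "(\<lambda>p. case (max 0 (min t (fst p)), snd p) of (s, \<omega>) \<Rightarrow> u s \<omega>)
      \<in> borel_measurable (borel \<Otimes>\<^sub>M F t)"
    by (rule measurable_compose)
  then show ?thesis
    by (simp add: split_beta')
qed

text \<open>The way back from the full line: the version \<open>g t\<close> may change with the
  horizon \<open>t\<close>, and has to agree with \<open>u\<close> only on
  \<open>{0..t}\<close>.\<close>

lemma progressively_measurableI:
  assumes "\<And>t. t \<in> {0..T} \<Longrightarrow> (\<lambda>(s, \<omega>). g t s \<omega>) \<in> borel_measurable (borel \<Otimes>\<^sub>M F t)"
    and "\<And>s t \<omega>. 0 \<le> s \<Longrightarrow> s \<le> t \<Longrightarrow> t \<le> T \<Longrightarrow> g t s \<omega> = u s \<omega>"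
  shows "progressively_measurable F T u"
  unfolding progressively_measurable_def
proof
  fix t assume t: "t \<in> {0..T}"
  have "(\<lambda>p. (fst p, snd p)) \<in> restrict_space borel {0..t} \<Otimes>\<^sub>M F t \<rightarrow>\<^sub>M (borel :: real measure) \<Otimes>\<^sub>M F t"
    by (intro measurable_Pair measurable_compose[OF measurable_fst] measurable_restrict_space1) auto
  from measurable_compose[OF this assms(1)[OF t]]
  have "(\<lambda>(s, \<omega>). g t s \<omega>) \<in> borel_measurable (restrict_space borel {0..t} \<Otimes>\<^sub>M F t)"
    by (simp add: split_beta')
  then show "(\<lambda>(s, \<omega>). u s \<omega>) \<in> borel_measurable (restrict_space borel {0..t} \<Otimes>\<^sub>M F t)"
    using t assms(2)
    by (subst measurable_cong[where g = "\<lambda>(s, \<omega>). g t s \<omega>"])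
      (auto simp: space_pair_measure space_restrict_space)
qed

lemma exp_filter_cong:
  assumes "\<And>r. 0 \<le> r \<Longrightarrow> r \<le> s \<Longrightarrow> f r = g r"
  shows "exp_filter lam x f s = exp_filter lam x g s"
  unfolding exp_filter_def set_lebesgue_integral_def
  using assms by (auto simp: indicator_def
      intro!: Bochner_Integration.integral_cong arg_cong[where f = "\<lambda>z. z / lam"])

text \<open>Causality: the filter at time \<open>s\<close> reads the path on \<open>{0..s}\<close>
  only, so up to the horizon \<open>t\<close> clamping the process at \<open>t\<close> changes
  nothing.\<close>

lemma progressively_measurable_feedback:
  assumes "progressively_measurable F T \<xi>"
  shows "progressively_measurable F T (\<lambda>t \<omega>. (\<xi> t \<omega> - exp_filter lam x (\<lambda>s. \<xi> s \<omega>) t) / lam)"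
proof (rule progressively_measurableI)
  let ?c = "\<lambda>t s \<omega>. \<xi> (max 0 (min t s)) \<omega>"
  fix t assume t: "t \<in> {0..T}"
  note [measurable] = progressively_measurable_clamp[OF assms t]
    borel_measurable_exp_filter[OF progressively_measurable_clamp[OF assms t]]
  show "(\<lambda>(s, \<omega>). (?c t s \<omega> - exp_filter lam x (\<lambda>r. ?c t r \<omega>) s) / lam)
      \<in> borel_measurable (borel \<Otimes>\<^sub>M F t)"
    by measurable
qed (auto intro!: exp_filter_cong)

section \<open>Square integrals over a bounded time interval\<close>

lemma set_integrable_of_square:
  fixes f :: "real \<Rightarrow> real"
  assumes [measurable]: "f \<in> borel_measurable borel"
    and fin: "(\<integral>\<^sup>+t\<in>{a..b}. ennreal ((f t)\<^sup>2) \<partial>lborel) < \<infinity>"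
  shows "set_integrable lborel {a..b} f"
proof -
  have "integrable lborel (\<lambda>t. indicator {a..b} t * (f t)\<^sup>2)"
    using fin by (intro integrableI_nonneg) (auto simp: indicator_mult_ennreal mult.commute)
  moreover have "integrable lborel (indicator {a..b} :: real \<Rightarrow> real)"
    by (intro integrable_real_indicator) (auto simp: emeasure_lborel_Icc_eq)
  ultimately have "integrable lborel (\<lambda>t. indicator {a..b} t + indicator {a..b} t * (f t)\<^sup>2)"
    by (rule Bochner_Integration.integrable_add[rotated])
  then show ?thesis
    unfolding set_integrable_def
  proof (rule Bochner_Integration.integrable_bound)
    \<comment> \<open>From \<open>(\<bar>z\<bar> - 1)\<^sup>2 \<ge> 0\<close>; the constant 1 is
      integrable because the interval is bounded.\<close>
    have "\<bar>z\<bar> \<le> 1 + z\<^sup>2" for z :: real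
      using sum_squares_ge_zero[of "\<bar>z\<bar> - 1" 0] zero_le_power2[of z]
      by (simp add: power2_eq_square algebra_simps)
    then show "AE t in lborel. norm (indicator {a..b} t *\<^sub>R f t)
        \<le> norm (indicator {a..b} t + indicator {a..b} t * (f t)\<^sup>2)"
      by (auto simp: indicator_def)
  qed simp
qed

lemma set_nn_integral_scale_square:
  fixes f :: "real \<Rightarrow> real"
  assumes [measurable]: "f \<in> borel_measurable borel"
  shows "(\<integral>\<^sup>+t\<in>{a..b}. ennreal ((f t / c)\<^sup>2) \<partial>lborel) =
    ennreal (1 / c\<^sup>2) * (\<integral>\<^sup>+t\<in>{a..b}. ennreal ((f t)\<^sup>2) \<partial>lborel)"
  by (subst nn_integral_cmult[symmetric])
    (auto intro!: nn_integral_cong simp: ennreal_mult'[symmetric] power_divide mult.assoc[symmetric])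

text \<open>Squaring halves the time scale of the decay, and the resulting 1/2 cancels the 2 from
  the splitting of the square. Hence the initial mismatch enters the final bound with coefficient
  \<open>lam\<close>, not \<open>2 * lam\<close>.\<close>

lemma set_nn_integral_exp_le:
  assumes "0 < lam" "0 \<le> T"
  shows "(\<integral>\<^sup>+t\<in>{0..T}. ennreal (2 * (exp (- t / lam))\<^sup>2) \<partial>lborel) \<le> ennreal lam"
proof -
  let ?F = "\<lambda>t. - lam * exp (- (2 * t) / lam)"
  have sq: "(exp (- t / lam))\<^sup>2 = exp (- (2 * t) / lam)" for t
    by (simp add: exp_double[symmetric])
  have "(\<integral>\<^sup>+t\<in>{0..T}. ennreal (2 * exp (- (2 * t) / lam)) \<partial>lborel) = ennreal (?F T - ?F 0)"
    using assms by (intro nn_integral_FTC_Icc) (auto intro!: derivative_eq_intros)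
  also have "\<dots> \<le> ennreal lam"
    using assms by (intro ennreal_leI) simp
  finally show ?thesis by (simp only: sq)
qed

section \<open>The feedback control for a jointly measurable target\<close>

text \<open>The time scale \<open>lam\<close> is the square root of the cost weight. Joint
  measurability on the whole time line is assumed on top of progressivity, which constrains only
  times in \<open>{0..T}\<close>; \<open>tracking_target_clamp_time\<close> provides it.\<close>

locale tracking_target = usual_filtered_prob_space M F T
  for M :: "'a measure" and F T +
  fixes \<eta> :: "real \<Rightarrow> 'a \<Rightarrow> real" and x lam :: real
  assumes lam_pos: "0 < lam"
    and progressive: "progressively_measurable F T \<eta>"
    and joint_measurable [measurable]: "(\<lambda>(s, \<omega>). \<eta> s \<omega>) \<in> borel_measurable (borel \<Otimes>\<^sub>M M)"
    and finite_energy: "expected_energy M T \<eta> < \<infinity>"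
    and initial_square_integrable: "integrable M (\<lambda>\<omega>. (\<eta> 0 \<omega>)\<^sup>2)"
begin

abbreviation filtered :: "real \<Rightarrow> 'a \<Rightarrow> real" where
  "filtered t \<omega> \<equiv> exp_filter lam x (\<lambda>s. \<eta> s \<omega>) t"

abbreviation feedback :: "real \<Rightarrow> 'a \<Rightarrow> real" where
  "feedback t \<omega> \<equiv> (\<eta> t \<omega> - filtered t \<omega>) / lam"

abbreviation delay :: "real measure" where
  "delay \<equiv> density lborel (exponential_density (1 / lam))"

definition tracking_error :: ennreal where
  "tracking_error = (\<integral>\<^sup>+\<omega>. (\<integral>\<^sup>+t\<in>{0..T}. ennreal ((filtered t \<omega> - \<eta> t \<omega>)\<^sup>2) \<partial>lborel) \<partial>M)"

text \<open>The delay is averaged after squaring, so this is Jensen's upper bound for the square of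
  the delay term in \<open>exp_filter_diff\<close>.\<close>

definition delay_error :: "real \<Rightarrow> 'a \<Rightarrow> ennreal" where
  "delay_error t \<omega> = (\<integral>\<^sup>+h. ennreal ((\<eta> (max (t - h) 0) \<omega> - \<eta> t \<omega>)\<^sup>2) \<partial>delay)"

lemma prob_space_delay: "prob_space delay"
  using lam_pos by (intro prob_space_exponential_density) simp

lemma path_measurable: "\<omega> \<in> space M \<Longrightarrow> (\<lambda>t. \<eta> t \<omega>) \<in> borel_measurable borel"
  by measurable

lemma filtered_measurable [measurable]:
  "(\<lambda>(s, \<omega>). filtered s \<omega>) \<in> borel_measurable (borel \<Otimes>\<^sub>M M)"
  by (rule borel_measurable_exp_filter[OF joint_measurable])

lemma delay_error_measurable [measurable]:
  "(\<lambda>(t, \<omega>). delay_error t \<omega>) \<in> borel_measurable (borel \<Otimes>\<^sub>M M)"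
proof -
  interpret P: prob_space delay by (rule prob_space_delay)
  have "(\<lambda>(p, h). ennreal ((\<eta> (max (fst p - h) 0) (snd p) - \<eta> (fst p) (snd p))\<^sup>2))
      \<in> borel_measurable ((borel \<Otimes>\<^sub>M M) \<Otimes>\<^sub>M delay)"
    by measurable
  then have "(\<lambda>p. \<integral>\<^sup>+h. ennreal ((\<eta> (max (fst p - h) 0) (snd p) - \<eta> (fst p) (snd p))\<^sup>2) \<partial>delay)
      \<in> borel_measurable (borel \<Otimes>\<^sub>M M)"
    by (rule P.borel_measurable_nn_integral)
  then show ?thesis
    by (simp add: delay_error_def split_beta')
qed

lemma AE_path_integrable: "AE \<omega> in M. set_integrable lborel {0..T} (\<lambda>t. \<eta> t \<omega>)"
proof -
  have "(\<lambda>(\<omega>, t). ennreal ((\<eta> t \<omega>)\<^sup>2) * indicator {0..T} t) \<in> borel_measurable (M \<Otimes>\<^sub>M lborel)"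
    by measurable
  then have "(\<lambda>\<omega>. \<integral>\<^sup>+t\<in>{0..T}. ennreal ((\<eta> t \<omega>)\<^sup>2) \<partial>lborel) \<in> borel_measurable M"
    by (rule lborel.borel_measurable_nn_integral)
  then have "AE \<omega> in M. (\<integral>\<^sup>+t\<in>{0..T}. ennreal ((\<eta> t \<omega>)\<^sup>2) \<partial>lborel) \<noteq> \<infinity>"
    using finite_energy by (intro nn_integral_PInf_AE) (auto simp: expected_energy_def)
  with AE_space show ?thesis
  proof eventually_elim
    case (elim \<omega>)
    then show ?case
      by (intro set_integrable_of_square path_measurable) (auto simp: less_top)
  qed
qed

text \<open>A single null set serves all times, because integrability of the path on
  \<open>{0..T}\<close> passes to every \<open>{0..t}\<close>.\<close>

lemma AE_controlled_state_feedback: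
  "AE \<omega> in M. \<forall>t\<in>{0..T}. controlled_state x feedback t \<omega> = filtered t \<omega>"
  using AE_path_integrable
proof eventually_elim
  case (elim \<omega>)
  show ?case
  proof
    fix t assume t: "t \<in> {0..T}"
    then have "set_integrable lborel {0..t} (\<lambda>t. \<eta> t \<omega>)"
      by (intro set_integrable_subset[OF elim]) auto
    with t lam_pos show "controlled_state x feedback t \<omega> = filtered t \<omega>"
      unfolding controlled_state_def by (intro exp_filter_integral_equation) auto
  qed
qed

lemma feedback_energy:
  assumes "\<omega> \<in> space M"
  shows "(\<integral>\<^sup>+t\<in>{0..T}. ennreal ((feedback t \<omega>)\<^sup>2) \<partial>lborel) =
    ennreal (1 / lam\<^sup>2) * (\<integral>\<^sup>+t\<in>{0..T}. ennreal ((filtered t \<omega> - \<eta> t \<omega>)\<^sup>2) \<partial>lborel)"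
proof -
  have "(\<lambda>t. \<eta> t \<omega> - filtered t \<omega>) \<in> borel_measurable borel"
    using assms by measurable
  from set_nn_integral_scale_square[OF this, where a = 0 and b = T and c = lam] show ?thesis
    by (simp only: power2_commute[of "filtered _ \<omega>"])
qed

lemma error_measurable:
  "(\<lambda>\<omega>. \<integral>\<^sup>+t\<in>{0..T}. ennreal ((filtered t \<omega> - \<eta> t \<omega>)\<^sup>2) \<partial>lborel) \<in> borel_measurable M"
proof -
  have "(\<lambda>(\<omega>, t). ennreal ((filtered t \<omega> - \<eta> t \<omega>)\<^sup>2) * indicator {0..T} t) \<in> borel_measurable (M \<Otimes>\<^sub>M lborel)"
    by measurable
  then show ?thesis
    by (rule lborel.borel_measurable_nn_integral)
qed

text \<open>The energy of the feedback is \<open>tracking_error\<close> divided by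
  \<open>lam\<^sup>2\<close>, so admissibility amounts to a finite error.\<close>

lemma feedback_control:
  assumes "tracking_error < \<infinity>"
  shows "feedback \<in> controls M F T"
proof -
  have "expected_energy M T feedback = ennreal (1 / lam\<^sup>2) * tracking_error"
    unfolding expected_energy_def tracking_error_def
    by (subst nn_integral_cmult[symmetric]) (auto intro!: nn_integral_cong feedback_energy error_measurable)
  also have "\<dots> < \<infinity>"
    using assms by (simp add: ennreal_mult_less_top)
  finally show ?thesis
    using progressively_measurable_feedback[OF progressive] by (simp add: controls_def)
qed

text \<open>With cost weight \<open>lam\<^sup>2\<close>, the factor \<open>1 / lam\<^sup>2\<close>
  of \<open>feedback_energy\<close> cancels and each part of the cost is half of the error.\<close>

lemma tracking_cost_feedback: "tracking_cost M T x \<eta> (lam\<^sup>2) feedback = tracking_error"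
  unfolding tracking_cost_def tracking_error_def
proof (rule nn_integral_cong_AE)
  show "AE \<omega> in M. ennreal (1 / 2) * (\<integral>\<^sup>+t\<in>{0..T}. ennreal ((controlled_state x feedback t \<omega> - \<eta> t \<omega>)\<^sup>2) \<partial>lborel)
      + ennreal (lam\<^sup>2 / 2) * (\<integral>\<^sup>+t\<in>{0..T}. ennreal ((feedback t \<omega>)\<^sup>2) \<partial>lborel)
      = (\<integral>\<^sup>+t\<in>{0..T}. ennreal ((filtered t \<omega> - \<eta> t \<omega>)\<^sup>2) \<partial>lborel)"
    using AE_controlled_state_feedback AE_space
  proof eventually_elim
    case (elim \<omega>)
    have "(\<integral>\<^sup>+t\<in>{0..T}. ennreal ((controlled_state x feedback t \<omega> - \<eta> t \<omega>)\<^sup>2) \<partial>lborel)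
        = (\<integral>\<^sup>+t\<in>{0..T}. ennreal ((filtered t \<omega> - \<eta> t \<omega>)\<^sup>2) \<partial>lborel)" (is "_ = ?E")
      using elim by (intro nn_integral_cong) (auto simp: indicator_def)
    moreover have "ennreal (lam\<^sup>2 / 2) * (ennreal (1 / lam\<^sup>2) * ?E) = ennreal (1 / 2) * ?E"
      using lam_pos by (simp add: mult.assoc[symmetric] ennreal_mult'[symmetric])
    moreover have "ennreal (1 / 2) * ?E + ennreal (1 / 2) * ?E = ?E"
    proof -
      have "ennreal (1 / 2) * ?E + ennreal (1 / 2) * ?E = (ennreal (1 / 2) + ennreal (1 / 2)) * ?E"
        by (rule distrib_right[symmetric])
      also have "ennreal (1 / 2) + ennreal (1 / 2) = 1"
        by (subst ennreal_plus[symmetric]) auto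
      finally show ?thesis by simp
    qed
    ultimately show ?case
      using feedback_energy[OF elim(2)] by simp
  qed
qed

text \<open>An infinite error makes the bound trivial; a finite one makes the feedback
  admissible.\<close>

lemma tracking_value_le_tracking_error:
  "tracking_value M F T x \<eta> (lam\<^sup>2) \<le> tracking_error"
proof (cases "tracking_error < \<infinity>")
  case True
  then have "tracking_value M F T x \<eta> (lam\<^sup>2) \<le> tracking_cost M T x \<eta> (lam\<^sup>2) feedback"
    unfolding tracking_value_def by (intro INF_lower feedback_control)
  then show ?thesis
    by (simp only: tracking_cost_feedback)
next
  case False
  then show ?thesis
    by (simp add: not_less top_unique)
qed

text \<open>The witness \<open>b\<close> is the mean increment over the random delay. Both error
  estimates below use only its two properties recorded here.\<close>

lemma filtered_diff:
  assumes "\<omega> \<in> space M" "set_integrable lborel {0..T} (\<lambda>t. \<eta> t \<omega>)" "t \<in> {0..T}"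
  obtains b where "filtered t \<omega> - \<eta> t \<omega> = exp (- t / lam) * (x - \<eta> 0 \<omega>) + b"
    and "ennreal (b\<^sup>2) \<le> delay_error t \<omega>"
proof
  interpret P: prob_space delay by (rule prob_space_delay)
  let ?b = "LINT h|delay. \<eta> (max (t - h) 0) \<omega> - \<eta> t \<omega>"
  note [measurable] = path_measurable[OF assms(1)]
  show "filtered t \<omega> - \<eta> t \<omega> = exp (- t / lam) * (x - \<eta> 0 \<omega>) + ?b"
    using assms lam_pos
    by (intro exp_filter_diff path_measurable set_integrable_subset[OF assms(2)]) auto
  have "(\<lambda>h. \<eta> (max (t - h) 0) \<omega> - \<eta> t \<omega>) \<in> borel_measurable delay"
    by measurable
  from P.square_expectation_le_nn_integral[OF this]
  show "ennreal (?b\<^sup>2) \<le> delay_error t \<omega>"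
    by (simp add: delay_error_def)
qed

text \<open>Two applications of Tonelli's theorem, path by path and then over \<open>M\<close>, move
  the delay integral outermost; the assumed power bound is then averaged over the delay.\<close>

lemma integral_delay_error:
  assumes "0 \<le> L" "0 < a" and bound: "\<And>h. 0 < h \<Longrightarrow> time_modulus M T \<eta> h \<le> ennreal (L * h powr a)"
  shows "(\<integral>\<^sup>+\<omega>. (\<integral>\<^sup>+t\<in>{0..T}. delay_error t \<omega> \<partial>lborel) \<partial>M) \<le> ennreal (L * (lam powr a * Gamma (a + 1)))"
proof -
  interpret P: prob_space delay by (rule prob_space_delay)
  interpret LP: pair_sigma_finite lborel delay ..
  interpret MP: pair_sigma_finite M delay ..
  define G where "G \<omega> t h = ennreal ((\<eta> (max (t - h) 0) \<omega> - \<eta> t \<omega>)\<^sup>2) * indicator {0..T} t" for \<omega> t h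
  have [measurable]: "(\<lambda>(\<omega>, t, h). G \<omega> t h) \<in> borel_measurable (M \<Otimes>\<^sub>M borel \<Otimes>\<^sub>M borel)"
    unfolding G_def by measurable
  have [measurable]: "(\<lambda>(\<omega>, h). \<integral>\<^sup>+t. G \<omega> t h \<partial>lborel) \<in> borel_measurable (M \<Otimes>\<^sub>M delay)"
  proof -
    have "(\<lambda>(p, t). G (fst p) t (snd p)) \<in> borel_measurable ((M \<Otimes>\<^sub>M delay) \<Otimes>\<^sub>M lborel)"
      unfolding G_def by measurable
    from lborel.borel_measurable_nn_integral[OF this] show ?thesis
      by (simp add: split_beta')
  qed
  have "(\<integral>\<^sup>+t\<in>{0..T}. delay_error t \<omega> \<partial>lborel) = (\<integral>\<^sup>+h. (\<integral>\<^sup>+t. G \<omega> t h \<partial>lborel) \<partial>delay)"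
    if "\<omega> \<in> space M" for \<omega>
  proof -
    note [measurable] = path_measurable[OF that]
    have "(\<lambda>(t, h). G \<omega> t h) \<in> borel_measurable (lborel \<Otimes>\<^sub>M delay)"
      unfolding G_def by measurable
    then have "(\<integral>\<^sup>+h. (\<integral>\<^sup>+t. G \<omega> t h \<partial>lborel) \<partial>delay) = (\<integral>\<^sup>+t. (\<integral>\<^sup>+h. G \<omega> t h \<partial>delay) \<partial>lborel)"
      by (rule LP.Fubini')
    also have "\<dots> = (\<integral>\<^sup>+t\<in>{0..T}. delay_error t \<omega> \<partial>lborel)"
      unfolding G_def delay_error_def
      by (intro nn_integral_cong nn_integral_multc) measurable
    finally show ?thesis ..
  qed
  then have "(\<integral>\<^sup>+\<omega>. (\<integral>\<^sup>+t\<in>{0..T}. delay_error t \<omega> \<partial>lborel) \<partial>M)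
      = (\<integral>\<^sup>+\<omega>. (\<integral>\<^sup>+h. (\<integral>\<^sup>+t. G \<omega> t h \<partial>lborel) \<partial>delay) \<partial>M)"
    by (rule nn_integral_cong)
  also have "\<dots> = (\<integral>\<^sup>+h. (\<integral>\<^sup>+\<omega>. (\<integral>\<^sup>+t. G \<omega> t h \<partial>lborel) \<partial>M) \<partial>delay)"
    by (rule MP.Fubini'[symmetric]) measurable
  \<comment> \<open>For a fixed delay the inner integrals form the time modulus, up to the order of
    the difference under the square.\<close>
  also have "\<dots> = (\<integral>\<^sup>+h. time_modulus M T \<eta> h \<partial>delay)"
    by (simp add: time_modulus_def G_def power2_commute[of "\<eta> (max _ 0) _"])
  also have "\<dots> \<le> (\<integral>\<^sup>+h. ennreal (L * h powr a) \<partial>delay)"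
  proof (rule nn_integral_mono_AE)
    \<comment> \<open>The bound is available for \<open>h > 0\<close> only: negative delays have
      density 0, and \<open>h = 0\<close> is a null set.\<close>
    have "AE h in lborel. h \<noteq> (0::real)"
      by (rule AE_lborel_singleton)
    then show "AE h in delay. time_modulus M T \<eta> h \<le> ennreal (L * h powr a)"
      by (subst AE_density) (auto simp: exponential_density_def bound elim!: eventually_mono)
  qed
  also have "\<dots> = ennreal L * ennreal (lam powr a * Gamma (a + 1))"
    using assms lam_pos
    by (simp add: ennreal_mult' nn_integral_cmult nn_integral_exponential_powr)
  finally show ?thesis
    using assms by (simp add: ennreal_mult')
qed

lemma tracking_error_le_same_start:
  assumes "AE \<omega> in M. x = \<eta> 0 \<omega>"
  shows "tracking_error \<le> (\<integral>\<^sup>+\<omega>. (\<integral>\<^sup>+t\<in>{0..T}. delay_error t \<omega> \<partial>lborel) \<partial>M)"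
  unfolding tracking_error_def
proof (rule nn_integral_mono_AE)
  show "AE \<omega> in M. (\<integral>\<^sup>+t\<in>{0..T}. ennreal ((filtered t \<omega> - \<eta> t \<omega>)\<^sup>2) \<partial>lborel)
      \<le> (\<integral>\<^sup>+t\<in>{0..T}. delay_error t \<omega> \<partial>lborel)"
    using assms AE_space AE_path_integrable
  proof eventually_elim
    case (elim \<omega>)
    have "ennreal ((filtered t \<omega> - \<eta> t \<omega>)\<^sup>2) \<le> delay_error t \<omega>" if "t \<in> {0..T}" for t
      using filtered_diff[OF elim(2,3) that] elim(1) by auto
    then show ?case
      by (intro nn_integral_mono) (auto simp: indicator_def)
  qed
qed

lemma tracking_error_le:
  "tracking_error \<le> ennreal (lam * (LINT \<omega>|M. (x - \<eta> 0 \<omega>)\<^sup>2))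
     + 2 * (\<integral>\<^sup>+\<omega>. (\<integral>\<^sup>+t\<in>{0..T}. delay_error t \<omega> \<partial>lborel) \<partial>M)"
proof -
  let ?D = "\<lambda>\<omega>. \<integral>\<^sup>+t\<in>{0..T}. delay_error t \<omega> \<partial>lborel"
  have [measurable]: "?D \<in> borel_measurable M"
  proof -
    have "(\<lambda>(\<omega>, t). delay_error t \<omega> * indicator {0..T} t) \<in> borel_measurable (M \<Otimes>\<^sub>M lborel)"
      by measurable
    then show ?thesis by (rule lborel.borel_measurable_nn_integral)
  qed
  have [measurable]: "(\<lambda>\<omega>. \<eta> 0 \<omega>) \<in> borel_measurable M"
    by measurable
  have "integrable M (\<lambda>\<omega>. \<eta> 0 \<omega>)"
    by (rule square_integrable_imp_integrable) (use initial_square_integrable in auto)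
  then have start: "integrable M (\<lambda>\<omega>. (x - \<eta> 0 \<omega>)\<^sup>2)"
    using initial_square_integrable by (simp add: power2_diff)
  have "tracking_error \<le> (\<integral>\<^sup>+\<omega>. ennreal lam * ennreal ((x - \<eta> 0 \<omega>)\<^sup>2) + 2 * ?D \<omega> \<partial>M)"
    unfolding tracking_error_def
  proof (rule nn_integral_mono_AE)
    show "AE \<omega> in M. (\<integral>\<^sup>+t\<in>{0..T}. ennreal ((filtered t \<omega> - \<eta> t \<omega>)\<^sup>2) \<partial>lborel)
        \<le> ennreal lam * ennreal ((x - \<eta> 0 \<omega>)\<^sup>2) + 2 * ?D \<omega>"
      using AE_space AE_path_integrable
    proof eventually_elim
      case (elim \<omega>)
      let ?e = "\<lambda>t. ennreal (2 * (exp (- t / lam))\<^sup>2) * indicator {0..T} t"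
      let ?c = "ennreal ((x - \<eta> 0 \<omega>)\<^sup>2)"
      have [measurable]: "(\<lambda>t. delay_error t \<omega>) \<in> borel_measurable borel"
        using elim by measurable
      have pointwise: "ennreal ((filtered t \<omega> - \<eta> t \<omega>)\<^sup>2)
          \<le> ennreal (2 * (exp (- t / lam))\<^sup>2) * ?c + 2 * delay_error t \<omega>" if t: "t \<in> {0..T}" for t
      proof -
        obtain b where b: "filtered t \<omega> - \<eta> t \<omega> = exp (- t / lam) * (x - \<eta> 0 \<omega>) + b"
          "ennreal (b\<^sup>2) \<le> delay_error t \<omega>"
          using filtered_diff[OF elim t] by blast
        \<comment> \<open>The difference of the two sides is \<open>(y - b)\<^sup>2\<close>.\<close>
        have "(y + b)\<^sup>2 \<le> 2 * y\<^sup>2 + 2 * b\<^sup>2" for y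
          using zero_le_power2[of "y - b"] by (simp add: power2_eq_square algebra_simps)
        from this[of "exp (- t / lam) * (x - \<eta> 0 \<omega>)"]
        have "ennreal ((filtered t \<omega> - \<eta> t \<omega>)\<^sup>2)
            \<le> ennreal (2 * (exp (- t / lam))\<^sup>2 * (x - \<eta> 0 \<omega>)\<^sup>2 + 2 * b\<^sup>2)"
          unfolding b by (intro ennreal_leI) (simp add: power_mult_distrib mult.assoc)
        also have "\<dots> = ennreal (2 * (exp (- t / lam))\<^sup>2) * ?c + 2 * ennreal (b\<^sup>2)"
          by (simp add: ennreal_mult')
        also have "\<dots> \<le> ennreal (2 * (exp (- t / lam))\<^sup>2) * ?c + 2 * delay_error t \<omega>"
          using b(2) by (intro add_left_mono mult_left_mono) auto
        finally show ?thesis .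
      qed
      have "(\<integral>\<^sup>+t\<in>{0..T}. ennreal ((filtered t \<omega> - \<eta> t \<omega>)\<^sup>2) \<partial>lborel)
          \<le> (\<integral>\<^sup>+t. ?e t * ?c + 2 * (delay_error t \<omega> * indicator {0..T} t) \<partial>lborel)"
        using pointwise by (intro nn_integral_mono) (auto simp: indicator_def)
      also have "\<dots> = (\<integral>\<^sup>+t. ?e t \<partial>lborel) * ?c + 2 * ?D \<omega>"
        by (simp add: nn_integral_add nn_integral_multc nn_integral_cmult)
      also have "\<dots> \<le> ennreal lam * ?c + 2 * ?D \<omega>"
        using set_nn_integral_exp_le[OF lam_pos, of T] T_pos
        by (intro add_right_mono mult_right_mono) auto
      finally show ?case .
    qed
  qed
  also have "\<dots> = ennreal lam * (\<integral>\<^sup>+\<omega>. ennreal ((x - \<eta> 0 \<omega>)\<^sup>2) \<partial>M) + 2 * (\<integral>\<^sup>+\<omega>. ?D \<omega> \<partial>M)"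
    by (simp add: nn_integral_add nn_integral_cmult)
  also have "(\<integral>\<^sup>+\<omega>. ennreal ((x - \<eta> 0 \<omega>)\<^sup>2) \<partial>M) = ennreal (LINT \<omega>|M. (x - \<eta> 0 \<omega>)\<^sup>2)"
    by (rule nn_integral_eq_integral[OF start]) simp
  finally show ?thesis
    using lam_pos by (simp add: ennreal_mult')
qed

end

section \<open>Reduction to a target clamped in time\<close>

text \<open>Progressive measurability says nothing about times outside \<open>[0, T]\<close>; clamping makes the process
  jointly measurable on the whole line.\<close>
definition clamp_time :: "real \<Rightarrow> (real \<Rightarrow> 'a \<Rightarrow> real) \<Rightarrow> real \<Rightarrow> 'a \<Rightarrow> real" where
  "clamp_time T \<xi> t = \<xi> (max 0 (min T t))"

lemma clamp_time_eq: "t \<in> {0..T} \<Longrightarrow> clamp_time T \<xi> t = \<xi> t"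
  by (simp add: clamp_time_def)

lemma expected_energy_clamp_time:
  "expected_energy M T (clamp_time T \<xi>) = expected_energy M T \<xi>"
  unfolding expected_energy_def
  by (intro nn_integral_cong) (auto simp: clamp_time_eq indicator_def)

text \<open>For \<open>h > 0\<close> the delayed time \<open>max (t - h) 0\<close> stays in
  \<open>{0..T}\<close>; for \<open>h < 0\<close> it could exceed \<open>T\<close>, where clamping
  may change the process.\<close>

lemma time_modulus_clamp_time:
  "0 < h \<Longrightarrow> time_modulus M T (clamp_time T \<xi>) h = time_modulus M T \<xi> h"
  unfolding time_modulus_def
  by (intro nn_integral_cong) (auto simp: clamp_time_eq indicator_def)

lemma tracking_value_clamp_time:
  "tracking_value M F T x (clamp_time T \<xi>) \<kappa> = tracking_value M F T x \<xi> \<kappa>"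
proof -
  have "(\<integral>\<^sup>+t\<in>{0..T}. ennreal ((controlled_state x u t \<omega> - clamp_time T \<xi> t \<omega>)\<^sup>2) \<partial>lborel)
      = (\<integral>\<^sup>+t\<in>{0..T}. ennreal ((controlled_state x u t \<omega> - \<xi> t \<omega>)\<^sup>2) \<partial>lborel)" for u \<omega>
    by (intro nn_integral_cong) (auto simp: clamp_time_eq indicator_def)
  then show ?thesis
    by (simp add: tracking_value_def tracking_cost_def)
qed

text \<open>Progressive measurability at the final horizon \<open>T\<close> gives joint
  measurability with respect to \<open>F T\<close>, and \<open>F T\<close> is a subalgebra of
  \<open>M\<close>.\<close>

lemma (in usual_filtered_prob_space) tracking_target_clamp_time:
  assumes prog: "progressively_measurable F T \<xi>"
    and "integrable M (\<lambda>\<omega>. (\<xi> 0 \<omega>)\<^sup>2)" "expected_energy M T \<xi> < \<infinity>" "0 < lam"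
  shows "tracking_target M F T (clamp_time T \<xi>) lam"
proof
  have T: "T \<in> {0..T}"
    using T_pos by simp
  have "(\<lambda>p. (fst p, snd p)) \<in> (borel :: real measure) \<Otimes>\<^sub>M M \<rightarrow>\<^sub>M borel \<Otimes>\<^sub>M F T"
    using measurable_from_subalg[OF subalg[OF T], of "\<lambda>\<omega>. \<omega>" "F T"]
    by (intro measurable_Pair measurable_fst measurable_compose[OF measurable_snd]) auto
  from measurable_compose[OF this progressively_measurable_clamp[OF prog T]]
  show "(\<lambda>(s, \<omega>). clamp_time T \<xi> s \<omega>) \<in> borel_measurable (borel \<Otimes>\<^sub>M M)"
    by (simp add: clamp_time_def split_beta')
  show "progressively_measurable F T (clamp_time T \<xi>)"
    using progressively_measurable_clamp[OF prog]
    by (rule progressively_measurableI) (auto simp: clamp_time_eq)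
  show "expected_energy M T (clamp_time T \<xi>) < \<infinity>"
    using assms by (simp add: expected_energy_clamp_time)
  show "integrable M (\<lambda>\<omega>. (clamp_time T \<xi> 0 \<omega>)\<^sup>2)"
    using assms T_pos by (simp add: clamp_time_eq)
qed fact

section \<open>Bounds on the value under a power modulus\<close>

context usual_filtered_prob_space
begin

text \<open>The case \<open>L = 0\<close> is included because the trace seminorm, which later takes
  the place of \<open>L\<close>, may vanish.\<close>

context
  fixes \<xi> :: "real \<Rightarrow> 'a \<Rightarrow> real" and \<kappa> L a :: real
  assumes target: "progressively_measurable F T \<xi>" "integrable M (\<lambda>\<omega>. (\<xi> 0 \<omega>)\<^sup>2)"
      "expected_energy M T \<xi> < \<infinity>"
    and \<kappa>: "0 < \<kappa>" and L: "0 \<le> L" and a: "0 < a"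
    and modulus: "\<And>h. 0 < h \<Longrightarrow> time_modulus M T \<xi> h \<le> ennreal (L * h powr a)"
begin

interpretation X: tracking_target M F T "clamp_time T \<xi>" x "sqrt \<kappa>" for x
  using tracking_target_clamp_time[OF target] \<kappa> by simp

lemma initial_clamp: "clamp_time T \<xi> 0 = \<xi> 0"
  using T_pos by (simp add: clamp_time_eq)

lemma delay_error_bound:
  "(\<integral>\<^sup>+\<omega>. (\<integral>\<^sup>+t\<in>{0..T}. X.delay_error t \<omega> \<partial>lborel) \<partial>M) \<le> ennreal (L * \<kappa> powr (a / 2) * Gamma (a + 1))"
proof -
  have "sqrt \<kappa> powr a = \<kappa> powr (a / 2)"
    using \<kappa> by (simp add: powr_half_sqrt[symmetric] powr_powr)
  then show ?thesis
    using X.integral_delay_error[OF L a] modulus by (simp add: time_modulus_clamp_time mult.assoc)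
qed

lemma tracking_value_bound:
  "tracking_value M F T x \<xi> \<kappa> \<le>
     ennreal (sqrt \<kappa> * (LINT \<omega>|M. (x - \<xi> 0 \<omega>)\<^sup>2) + 2 * L * \<kappa> powr (a / 2) * Gamma (a + 1))"
proof -
  have "tracking_value M F T x \<xi> \<kappa> \<le> X.tracking_error x"
    using X.tracking_value_le_tracking_error[of x] \<kappa> by (simp add: tracking_value_clamp_time)
  also have "\<dots> \<le> ennreal (sqrt \<kappa> * (LINT \<omega>|M. (x - \<xi> 0 \<omega>)\<^sup>2))
      + 2 * (\<integral>\<^sup>+\<omega>. (\<integral>\<^sup>+t\<in>{0..T}. X.delay_error t \<omega> \<partial>lborel) \<partial>M)"
    using X.tracking_error_le[of x] by (simp add: initial_clamp)
  also have "\<dots> \<le> ennreal (sqrt \<kappa> * (LINT \<omega>|M. (x - \<xi> 0 \<omega>)\<^sup>2))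
      + 2 * ennreal (L * \<kappa> powr (a / 2) * Gamma (a + 1))"
    by (intro add_left_mono mult_left_mono delay_error_bound) auto
  also have "\<dots> = ennreal (sqrt \<kappa> * (LINT \<omega>|M. (x - \<xi> 0 \<omega>)\<^sup>2)
      + 2 * L * \<kappa> powr (a / 2) * Gamma (a + 1))"
    using \<kappa> L a by (simp add: ennreal_mult' Gamma_real_nonneg mult.assoc)
  finally show ?thesis .
qed

lemma tracking_value_bound_same_start:
  assumes "AE \<omega> in M. x = \<xi> 0 \<omega>"
  shows "tracking_value M F T x \<xi> \<kappa> \<le> ennreal (L * \<kappa> powr (a / 2) * Gamma (a + 1))"
proof -
  have "tracking_value M F T x \<xi> \<kappa> \<le> X.tracking_error x"
    using X.tracking_value_le_tracking_error[of x] \<kappa> by (simp add: tracking_value_clamp_time)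
  also have "\<dots> \<le> (\<integral>\<^sup>+\<omega>. (\<integral>\<^sup>+t\<in>{0..T}. X.delay_error t \<omega> \<partial>lborel) \<partial>M)"
    using X.tracking_error_le_same_start[of x] assms by (simp add: initial_clamp)
  finally show ?thesis
    using delay_error_bound by (rule order_trans)
qed

end

end

section \<open>The trace seminorm and the final estimates\<close>

text \<open>Puts a finite seminorm into the shape of the power modulus with exponent 1 and a real
  constant.\<close>

lemma time_modulus_le_tr_seminorm_sq:
  assumes "tr_seminorm_sq M T \<xi> < \<infinity>" "0 < h"
  shows "time_modulus M T \<xi> h \<le> ennreal (enn2real (tr_seminorm_sq M T \<xi>) * h powr 1)"
proof -
  have "time_modulus M T \<xi> h = time_modulus M T \<xi> h / ennreal h * ennreal h"
    using assms(2) by (simp add: ennreal_divide_times)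
  also have "\<dots> \<le> tr_seminorm_sq M T \<xi> * ennreal h"
    unfolding tr_seminorm_sq_def using assms(2) by (intro mult_right_mono SUP_upper) auto
  also have "\<dots> = ennreal (enn2real (tr_seminorm_sq M T \<xi>) * h powr 1)"
    using assms by (simp add: ennreal_mult')
  finally show ?thesis .
qed

theorem corollary2p3:
  fixes M :: "'a measure" and F :: "real \<Rightarrow> 'a measure" and T x :: real
    and \<xi> :: "real \<Rightarrow> 'a \<Rightarrow> real"
  assumes "usual_filtered_prob_space M F T"
    and "progressively_measurable F T \<xi>"
    and "\<xi> 0 \<in> borel_measurable M" and "integrable M (\<lambda>\<omega>. (\<xi> 0 \<omega>)\<^sup>2)"
    and "expected_energy M T \<xi> < \<infinity>"
  shows "(\<forall>L>0. \<forall>\<alpha>>0. (\<forall>h>0. time_modulus M T \<xi> h \<le> ennreal (L * h powr \<alpha>)) \<longrightarrow>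
            (\<forall>\<kappa>>0. tracking_value M F T x \<xi> \<kappa> \<le>
               ennreal (sqrt \<kappa> * (LINT \<omega>|M. (x - \<xi> 0 \<omega>)\<^sup>2)
                        + 2 * L * \<kappa> powr (\<alpha> / 2) * Gamma (\<alpha> + 1))) \<and>
            (\<forall>\<kappa>. 0 < \<kappa> \<and> \<kappa> \<le> 1 \<longrightarrow> tracking_value M F T x \<xi> \<kappa> \<le>
               ennreal (\<kappa> powr (min \<alpha> 1 / 2) *
                        ((LINT \<omega>|M. (x - \<xi> 0 \<omega>)\<^sup>2) + 2 * L * Gamma (\<alpha> + 1)))))
       \<and> (tr_seminorm_sq M T \<xi> < \<infinity> \<longrightarrow>
            (\<forall>\<kappa>>0. tracking_value M F T x \<xi> \<kappa> \<le>
               ennreal (sqrt \<kappa>) *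
                 (ennreal (LINT \<omega>|M. (x - \<xi> 0 \<omega>)\<^sup>2) + 2 * tr_seminorm_sq M T \<xi>)))
       \<and> ((AE \<omega> in M. x = \<xi> 0 \<omega>) \<longrightarrow>
            (\<forall>L>0. \<forall>\<alpha>>0. (\<forall>h>0. time_modulus M T \<xi> h \<le> ennreal (L * h powr \<alpha>)) \<longrightarrow>
               (\<forall>\<kappa>>0. tracking_value M F T x \<xi> \<kappa> \<le>
                  ennreal (L * \<kappa> powr (\<alpha> / 2) * Gamma (\<alpha> + 1)))))"
  (is "?bounds \<and> ?trace \<and> ?sharp")
proof -
  interpret usual_filtered_prob_space M F T by fact
  note target = assms(2,4,5)
  let ?e = "LINT \<omega>|M. (x - \<xi> 0 \<omega>)\<^sup>2"
  have e: "0 \<le> ?e"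
    by (intro Bochner_Integration.integral_nonneg) simp
  have ?bounds
  proof (intro allI impI conjI; (elim conjE)?)
    fix L \<alpha> \<kappa> :: real
    assume L: "0 < L" and \<alpha>: "0 < \<alpha>" and mod: "\<forall>h>0. time_modulus M T \<xi> h \<le> ennreal (L * h powr \<alpha>)"
      and \<kappa>: "0 < \<kappa>"
    note bound = tracking_value_bound[OF target \<kappa> _ \<alpha>, of L x]
    show main: "tracking_value M F T x \<xi> \<kappa> \<le>
        ennreal (sqrt \<kappa> * ?e + 2 * L * \<kappa> powr (\<alpha> / 2) * Gamma (\<alpha> + 1))"
      using bound L mod by simp
    assume "\<kappa> \<le> 1"
    have G: "0 \<le> Gamma (\<alpha> + 1)"
      using \<alpha> by (simp add: Gamma_real_nonneg)
    \<comment> \<open>For \<open>\<kappa> \<le> 1\<close> a smaller exponent gives a larger power,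
      and \<open>min \<alpha> 1 / 2\<close> is at most both \<open>1 / 2\<close> and
      \<open>\<alpha> / 2\<close>.\<close>
    have "sqrt \<kappa> \<le> \<kappa> powr (min \<alpha> 1 / 2)"
      using \<kappa> \<open>\<kappa> \<le> 1\<close> by (simp add: powr_half_sqrt[symmetric] powr_mono')
    moreover have "\<kappa> powr (\<alpha> / 2) \<le> \<kappa> powr (min \<alpha> 1 / 2)"
      using \<kappa> \<open>\<kappa> \<le> 1\<close> by (simp add: powr_mono')
    ultimately have "sqrt \<kappa> * ?e + \<kappa> powr (\<alpha> / 2) * (2 * L * Gamma (\<alpha> + 1))
        \<le> \<kappa> powr (min \<alpha> 1 / 2) * ?e + \<kappa> powr (min \<alpha> 1 / 2) * (2 * L * Gamma (\<alpha> + 1))"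
      using e G L by (intro add_mono mult_right_mono) auto
    then have "sqrt \<kappa> * ?e + 2 * L * \<kappa> powr (\<alpha> / 2) * Gamma (\<alpha> + 1)
        \<le> \<kappa> powr (min \<alpha> 1 / 2) * (?e + 2 * L * Gamma (\<alpha> + 1))"
      by (simp add: algebra_simps)
    with main show "tracking_value M F T x \<xi> \<kappa> \<le>
        ennreal (\<kappa> powr (min \<alpha> 1 / 2) * (?e + 2 * L * Gamma (\<alpha> + 1)))"
      by (meson ennreal_leI order_trans)
  qed
  moreover have ?trace
  proof (intro impI allI)
    fix \<kappa> :: real
    assume fin: "tr_seminorm_sq M T \<xi> < \<infinity>" and \<kappa>: "0 < \<kappa>"
    let ?S = "enn2real (tr_seminorm_sq M T \<xi>)"
    have "tracking_value M F T x \<xi> \<kappa> \<le> ennreal (sqrt \<kappa> * ?e + 2 * ?S * \<kappa> powr (1 / 2) * Gamma (1 + 1))"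
      using time_modulus_le_tr_seminorm_sq[OF fin] by (intro tracking_value_bound[OF target \<kappa>]) auto
    \<comment> \<open>At exponent 1 the Gamma factor is \<open>Gamma 2 = 1\<close>, and both terms
      scale like \<open>sqrt \<kappa>\<close>.\<close>
    also have "\<dots> = ennreal (sqrt \<kappa> * (?e + 2 * ?S))"
      using \<kappa> by (simp add: powr_half_sqrt Gamma_numeral algebra_simps)
    also have "\<dots> = ennreal (sqrt \<kappa>) * (ennreal ?e + 2 * ennreal ?S)"
      using \<kappa> e by (simp add: ennreal_mult')
    finally show "tracking_value M F T x \<xi> \<kappa> \<le> ennreal (sqrt \<kappa>) * (ennreal ?e + 2 * tr_seminorm_sq M T \<xi>)"
      using fin by simp
  qed
  moreover have ?sharp
    using tracking_value_bound_same_start[OF target] by (simp add: less_imp_le)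
  ultimately show ?thesis by blast
qed

end
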